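(* Let $\alpha>0$ and, for each number of teams $t\ge2$, let $I_{\mathrm D t}$ be the prior under which $(\pi_1,\dots,\pi_t)$ has the symmetric Dirichlet distribution with all parameters equal to $\alpha$, i.e. $$f_\Pi(\pi|I_{\mathrm D t})=\frac{\Gamma(t\alpha)}{\Gamma(\alpha)^t}\left(\prod_{i=1}^t\pi_i^{\alpha-1}\right)\delta\left(1-\sum_{i=1}^t\pi_i\right).$$ This family of priors satisfies invariance under interchange of teams, normalizability, and invariance under elimination of teams, but it does not satisfy invariance under interchange of winning and losing: for $t=3$, $$f_\Gamma(\gamma|I_{\mathrm D3})\propto\left(e^{\frac{\gamma_{12}+\gamma_{13}}3}+e^{\frac{-\gamma_{12}+\gamma_{23}}3}+e^{\frac{-\gamma_{13}-\gamma_{23}}3}\right)^{-3\alpha},$$ and $f_\Gamma(\gamma|I_{\mathrm D3})\ne f_\Gamma(-\gamma|I_{\mathrm D3})$.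
   Context: Bradley-Terry model: $t$ teams have strengths $\pi=(\pi_1,\dots,\pi_t)\in(0,\infty)^t$; $\lambda_i=\ln\pi_i$, $\gamma_{ij}=\lambda_i-\lambda_j$. Let $\gamma=(\gamma_{1t},\dots,\gamma_{(t-1)t})\in\mathbb R^{t-1}$ (any other linear basis of the differences may be used, since changes of basis have constant Jacobian); every $\gamma_{ij}$ is a linear function of $\gamma$. A prior distribution on $\pi$ induces a density $f_\Gamma(\gamma|I)$ of $\gamma$. Two priors are equivalent ($\cong$) if their induced densities $f_\Gamma$ are equal (almost everywhere). $\delta$ is the Dirac delta function (the Dirichlet distribution is the usual one supported on the simplex $\sum_i\pi_i=1$), and in the displayed prior $\Gamma(\cdot)$ is the Gamma function. Desiderata: 1. Invariance under interchange of teams: for any $i\ne j$, the transformation exchanging $\pi_i$ and $\pi_j$ and fixing all other $\pi_k$ transforms the prior into an equivalent one. 2. Invariance under interchange of winning and losing: the transformation $\pi_i\to1/\pi_i$ for all $i$ transforms the prior into an equivalent one; equivalently $f_\Gamma(\gamma|I)=f_\Gamma(-\gamma|I)$. 3. Normalizability: $f_\Gamma$ is a proper prior, i.e. can be normalized to $\int_{\mathbb R^{t-1}}f_\Gamma(\gamma|I)\,d^{t-1}\gamma=1$. 4. Invariance under elimination of teams (for a family of priors, one for each number of teams): for every $t>2$, the prior for $t-1$ teams is equivalent to the marginal distribution of the first $t-1$ strengths under the prior for $t$ teams. *)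

theory Defs
  imports "HOL-Probability.Probability" "HOL-Combinatorics.Transposition"
begin

text \<open>
  Teams are numbered \<open>1, \<dots>, t\<close>. A prior on the strengths is a measure on \<open>strength_space t\<close>
  concentrated on positive vectors; it need not be finite.
\<close>

definition strength_space :: "nat \<Rightarrow> (nat \<Rightarrow> real) measure" where
  "strength_space t = PiM {1..t} (\<lambda>_. borel)"

definition gamma_space :: "nat \<Rightarrow> (nat \<Rightarrow> real) measure" where
  "gamma_space t = PiM {1..<t} (\<lambda>_. lborel)"

text \<open>The coordinates are the log strength ratios \<open>\<gamma>\<^sub>i\<^sub>t = \<lambda>\<^sub>i - \<lambda>\<^sub>t\<close> for \<open>i < t\<close>.\<close>

definition gamma_of :: "nat \<Rightarrow> (nat \<Rightarrow> real) \<Rightarrow> (nat \<Rightarrow> real)" where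
  "gamma_of t \<pi> = (\<lambda>i\<in>{1..<t}. ln (\<pi> i) - ln (\<pi> t))"

text \<open>\<open>\<gamma>\<^sub>i\<^sub>j\<close> as a linear function of these coordinates, with \<open>\<gamma>\<^sub>t\<^sub>t = 0\<close>.\<close>

definition gamma_diff :: "nat \<Rightarrow> (nat \<Rightarrow> real) \<Rightarrow> nat \<Rightarrow> nat \<Rightarrow> real" where
  "gamma_diff t \<gamma> i j = (if i = t then 0 else \<gamma> i) - (if j = t then 0 else \<gamma> j)"

definition neg_gamma :: "nat \<Rightarrow> (nat \<Rightarrow> real) \<Rightarrow> (nat \<Rightarrow> real)" where
  "neg_gamma t \<gamma> = (\<lambda>i\<in>{1..<t}. - \<gamma> i)"

text \<open>
  \<open>f\<close> is (a version of) the density \<open>f\<^sub>\<Gamma>\<close> induced by the prior \<open>P\<close>; it is determined only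
  almost everywhere, whence a relation.
\<close>

definition induces_density ::
    "nat \<Rightarrow> (nat \<Rightarrow> real) measure \<Rightarrow> ((nat \<Rightarrow> real) \<Rightarrow> ennreal) \<Rightarrow> bool" where
  "induces_density t P f \<longleftrightarrow> distributed P (gamma_space t) (gamma_of t) f"

definition prior_equiv ::
    "nat \<Rightarrow> (nat \<Rightarrow> real) measure \<Rightarrow> (nat \<Rightarrow> real) measure \<Rightarrow> bool" where
  "prior_equiv t P Q \<longleftrightarrow>
     (\<exists>f g. induces_density t P f \<and> induces_density t Q g \<and>
            (AE \<gamma> in gamma_space t. f \<gamma> = g \<gamma>))"

definition team_interchange_invariant :: "nat \<Rightarrow> (nat \<Rightarrow> real) measure \<Rightarrow> bool" where
  "team_interchange_invariant t P \<longleftrightarrow>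
     (\<forall>i\<in>{1..t}. \<forall>j\<in>{1..t}. i \<noteq> j \<longrightarrow>
        prior_equiv t (distr P (strength_space t)
          (\<lambda>\<pi>. \<lambda>k\<in>{1..t}. \<pi> (Transposition.transpose i j k))) P)"

definition win_loss_invariant :: "nat \<Rightarrow> (nat \<Rightarrow> real) measure \<Rightarrow> bool" where
  "win_loss_invariant t P \<longleftrightarrow>
     prior_equiv t (distr P (strength_space t) (\<lambda>\<pi>. \<lambda>k\<in>{1..t}. 1 / \<pi> k)) P"

definition normalizable :: "nat \<Rightarrow> (nat \<Rightarrow> real) measure \<Rightarrow> bool" where
  "normalizable t P \<longleftrightarrow>
     (\<exists>f. induces_density t P f \<and>
        (\<exists>c::real. c > 0 \<and> (\<integral>\<^sup>+ \<gamma>. ennreal c * f \<gamma> \<partial>gamma_space t) = 1))"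

definition elimination_invariant :: "(nat \<Rightarrow> (nat \<Rightarrow> real) measure) \<Rightarrow> bool" where
  "elimination_invariant I \<longleftrightarrow>
     (\<forall>t>2. prior_equiv (t - 1) (I (t - 1))
        (distr (I t) (strength_space (t - 1)) (\<lambda>\<pi>. restrict \<pi> {1..t - 1})))"

text \<open>
  The measure \<open>\<delta>(1 - \<Sum>\<^sub>i \<pi>\<^sub>i) d\<pi>\<^sub>1 \<dots> d\<pi>\<^sub>t\<close>: integrating out \<open>\<pi>\<^sub>t\<close> against the delta function
  leaves Lebesgue measure in the other coordinates and sets \<open>\<pi>\<^sub>t = 1 - \<Sum>\<^sub>i\<^sub><\<^sub>t \<pi>\<^sub>i\<close>.
\<close>

definition delta_sum_one :: "nat \<Rightarrow> (nat \<Rightarrow> real) measure" where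
  "delta_sum_one t =
     distr (PiM {1..<t} (\<lambda>_. lborel)) (strength_space t) (\<lambda>x. x(t := 1 - (\<Sum>i=1..<t. x i)))"

definition dirichlet_prior :: "real \<Rightarrow> nat \<Rightarrow> (nat \<Rightarrow> real) measure" where
  "dirichlet_prior \<alpha> t =
     density (delta_sum_one t)
       (\<lambda>\<pi>. ennreal (Gamma (real t * \<alpha>) / Gamma \<alpha> ^ t * (\<Prod>i=1..t. \<pi> i powr (\<alpha> - 1)))
             * indicator {\<pi>. \<forall>i\<in>{1..t}. 0 < \<pi> i} \<pi>)"

end

(*
  If x_1, ..., x_t are independent Gamma(alpha) variables, the normalised vector x / sum x is
  Dirichlet distributed, so every scale invariant function, in particular the log strength
  ratios and anything computed from them, has the same law under the Dirichlet prior as under the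
  independent sample.  Exchangeability, normalizability and elimination are evident for the
  sample.  Conditioning on x_t makes the log ratios independent, and integrating x_t out gives
  the density exp(alpha sum gamma_i) / (1 + sum exp gamma_i)^(t alpha) up to a constant.  For t = 3
  this is strictly larger at gamma than at -gamma on the box where exp(gamma_i / 3) is in (4, 5).
*)
theory Submission imports Defs begin


text \<open>The map from the simplex to the log ratios is nonlinear, and changing variables along it
  directly would need a determinant in t - 1 dimensions. Once x_t is fixed, the ratios of the sample
  are coordinatewise images, so substitutions on the real line suffice. Elimination is where the
  simplex is most awkward: the first t - 1 entries of a Dirichlet vector do not sum to 1. Dropping
  entries of the sample leaves a sample, so exchange and elimination are both reindexings by an
  injection. Versions of a density agree only almost everywhere, so the asymmetry has to be shown on
  a set of positive measure. For t = 3, with strengths scaled to product 1, the density is a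
  negative power of their sum, and negating the log ratios turns this sum into the sum of
  reciprocals. At strengths x^3, x^3, 1 the second sum exceeds the first by (x - 1)^3 (x + 1) / x^2,
  so two equal favourites already break the symmetry.\<close>

section \<open>Densities, images and dilations of finite product measures\<close>

text \<open>A product of sigma-finite measures is determined by its values on boxes, and there
  Tonelli factors the integral. Sigma-finiteness of the weighted factors is a separate assumption
  because a density with infinite values can destroy it.\<close>

lemma PiM_density:
  assumes I: "finite I"
    and M: "\<And>i. sigma_finite_measure (M i)"
    and N: "\<And>i. sigma_finite_measure (density (M i) (f i))"
    and f[measurable]: "\<And>i. f i \<in> borel_measurable (M i)"
  shows "PiM I (\<lambda>i. density (M i) (f i)) = density (PiM I M) (\<lambda>x. \<Prod>i\<in>I. f i (x i))"
proof -
  interpret M: product_sigma_finite M by (rule product_sigma_finite.intro[OF M])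
  interpret N: product_sigma_finite "\<lambda>i. density (M i) (f i)" by (rule product_sigma_finite.intro[OF N])
  show ?thesis
  proof (rule N.PiM_eqI[symmetric, OF I])
    show "sets (density (PiM I M) (\<lambda>x. \<Prod>i\<in>I. f i (x i))) = sets (PiM I (\<lambda>i. density (M i) (f i)))"
      by (simp cong: sets_PiM_cong)
    fix A assume "\<And>i. i \<in> I \<Longrightarrow> A i \<in> sets (density (M i) (f i))"
    then have A[measurable]: "\<And>i. i \<in> I \<Longrightarrow> A i \<in> sets (M i)" by simp
    have "emeasure (density (PiM I M) (\<lambda>x. \<Prod>i\<in>I. f i (x i))) (Pi\<^sub>E I A)
        = (\<integral>\<^sup>+x. (\<Prod>i\<in>I. f i (x i)) * indicator (Pi\<^sub>E I A) x \<partial>PiM I M)"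
      using I by (intro emeasure_density) (auto intro!: sets_PiM_I_finite borel_measurable_prod_ennreal)
    also have "\<dots> = (\<integral>\<^sup>+x. (\<Prod>i\<in>I. f i (x i) * indicator (A i) (x i)) \<partial>PiM I M)"
    proof (rule nn_integral_cong)
      fix x assume "x \<in> space (PiM I M)"
      then have "indicator (Pi\<^sub>E I A) x = (\<Prod>i\<in>I. indicator (A i) (x i) :: ennreal)"
        using I by (auto simp: space_PiM PiE_iff indicator_def prod_zero_iff)
      then show "(\<Prod>i\<in>I. f i (x i)) * indicator (Pi\<^sub>E I A) x = (\<Prod>i\<in>I. f i (x i) * indicator (A i) (x i))"
        by (simp add: prod.distrib)
    qed
    also have "\<dots> = (\<Prod>i\<in>I. \<integral>\<^sup>+x. f i x * indicator (A i) x \<partial>M i)"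
      using I by (intro M.product_nn_integral_prod) auto
    also have "\<dots> = (\<Prod>i\<in>I. emeasure (density (M i) (f i)) (A i))"
      by (intro prod.cong refl) (simp add: emeasure_density)
    finally show "emeasure (density (PiM I M) (\<lambda>x. \<Prod>i\<in>I. f i (x i))) (Pi\<^sub>E I A) = \<dots>" .
  qed
qed

text \<open>The preimage of a box under a coordinatewise map is the box of the preimages, so both
  sides agree on boxes.\<close>

lemma distr_PiM_componentwise:
  assumes I: "finite I"
    and M: "\<And>i. sigma_finite_measure (M i)"
    and N: "\<And>i. sigma_finite_measure (distr (M i) (N i) (g i))"
    and g[measurable]: "\<And>i. g i \<in> measurable (M i) (N i)"
  shows "distr (PiM I M) (PiM I N) (\<lambda>x. \<lambda>i\<in>I. g i (x i)) = PiM I (\<lambda>i. distr (M i) (N i) (g i))"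
proof -
  interpret M: product_sigma_finite M by (rule product_sigma_finite.intro[OF M])
  interpret N: product_sigma_finite "\<lambda>i. distr (M i) (N i) (g i)" by (rule product_sigma_finite.intro[OF N])
  show ?thesis
  proof (rule N.PiM_eqI[OF I])
    show "sets (distr (PiM I M) (PiM I N) (\<lambda>x. \<lambda>i\<in>I. g i (x i))) = sets (PiM I (\<lambda>i. distr (M i) (N i) (g i)))"
      by (simp cong: sets_PiM_cong)
    fix A assume "\<And>i. i \<in> I \<Longrightarrow> A i \<in> sets (distr (M i) (N i) (g i))"
    then have A[measurable]: "\<And>i. i \<in> I \<Longrightarrow> A i \<in> sets (N i)" by simp
    have "(\<lambda>x. \<lambda>i\<in>I. g i (x i)) -` Pi\<^sub>E I A \<inter> space (PiM I M) = Pi\<^sub>E I (\<lambda>i. g i -` A i \<inter> space (M i))"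
      by (auto simp: space_PiM PiE_iff)
    then have "emeasure (distr (PiM I M) (PiM I N) (\<lambda>x. \<lambda>i\<in>I. g i (x i))) (Pi\<^sub>E I A)
        = emeasure (PiM I M) (Pi\<^sub>E I (\<lambda>i. g i -` A i \<inter> space (M i)))"
      using I by (subst emeasure_distr) (auto intro!: sets_PiM_I_finite measurable_restrict)
    also have "\<dots> = (\<Prod>i\<in>I. emeasure (M i) (g i -` A i \<inter> space (M i)))"
      using I by (intro M.emeasure_PiM) auto
    also have "\<dots> = (\<Prod>i\<in>I. emeasure (distr (M i) (N i) (g i)) (A i))"
      by (intro prod.cong refl) (simp add: emeasure_distr)
    finally show "emeasure (distr (PiM I M) (PiM I N) (\<lambda>x. \<lambda>i\<in>I. g i (x i))) (Pi\<^sub>E I A) = \<dots>" .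
  qed
qed

text \<open>The factor \<open>r ^ card I\<close> is the Jacobian of a dilation. It is assembled from
  one-dimensional scalings, each of which has the constant density 1/r.\<close>

lemma nn_integral_PiM_lborel_scale:
  assumes I: "finite I" and r: "0 < r"
    and h[measurable]: "h \<in> borel_measurable (PiM I (\<lambda>_. lborel))"
  shows "(\<integral>\<^sup>+x. h x \<partial>PiM I (\<lambda>_. lborel))
       = ennreal (r ^ card I) * (\<integral>\<^sup>+y. h (\<lambda>i\<in>I. r * y i) \<partial>PiM I (\<lambda>_. lborel))"
proof -
  have fin: "sigma_finite_measure (density lborel (\<lambda>_::real. ennreal (inverse r)))"
    by (subst sigma_finite_measure.sigma_finite_iff_density_finite) (auto simp: sigma_finite_lborel)
  have d: "distr lborel lborel ((*) r) = density lborel (\<lambda>_. ennreal (inverse r))"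
    using lborel_distr_mult[of r] r by (simp cong: distr_cong)
  have "distr (PiM I (\<lambda>_. lborel)) (PiM I (\<lambda>_. lborel)) (\<lambda>y. \<lambda>i\<in>I. r * y i)
      = PiM I (\<lambda>_. density lborel (\<lambda>_. ennreal (inverse r)))"
    using distr_PiM_componentwise[OF I, of "\<lambda>_. lborel" "\<lambda>_. lborel" "\<lambda>_. (*) r"] d fin
    by (simp add: lborel.sigma_finite_measure_axioms)
  also have "\<dots> = density (PiM I (\<lambda>_. lborel)) (\<lambda>_. ennreal (inverse r) ^ card I)"
    using fin by (subst PiM_density[OF I]) (auto simp: lborel.sigma_finite_measure_axioms)
  finally have e: "distr (PiM I (\<lambda>_. lborel)) (PiM I (\<lambda>_. lborel)) (\<lambda>y. \<lambda>i\<in>I. r * y i)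
      = density (PiM I (\<lambda>_. lborel)) (\<lambda>_. ennreal (inverse r) ^ card I)" .
  have "(\<integral>\<^sup>+y. h (\<lambda>i\<in>I. r * y i) \<partial>PiM I (\<lambda>_. lborel))
      = (\<integral>\<^sup>+x. h x \<partial>distr (PiM I (\<lambda>_. lborel)) (PiM I (\<lambda>_. lborel)) (\<lambda>y. \<lambda>i\<in>I. r * y i))"
    by (subst nn_integral_distr) auto
  also have "\<dots> = ennreal (inverse r) ^ card I * (\<integral>\<^sup>+x. h x \<partial>PiM I (\<lambda>_. lborel))"
    unfolding e by (subst nn_integral_density) (auto simp: nn_integral_cmult)
  finally have *: "(\<integral>\<^sup>+y. h (\<lambda>i\<in>I. r * y i) \<partial>PiM I (\<lambda>_. lborel)) = \<dots>" .
  have "ennreal (r ^ card I) * ennreal (inverse r) ^ card I = 1"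
    using r by (simp add: ennreal_power flip: ennreal_mult power_mult_distrib)
  then show ?thesis
    unfolding * by (simp flip: mult.assoc)
qed

section \<open>Exponential substitution and the Gamma integral\<close>

text \<open>The intervals [exp(-n), exp n] exhaust the positive half-line; the substitution is made
  on each of them, and monotone convergence gives the limit.\<close>

lemma nn_integral_exp_substitution:
  fixes h :: "real \<Rightarrow> ennreal"
  assumes h[measurable]: "h \<in> borel_measurable borel"
  shows "(\<integral>\<^sup>+x. h x * indicator {0<..} x \<partial>lborel) = (\<integral>\<^sup>+y. h (exp y) * ennreal (exp y) \<partial>lborel)"
proof -
  have U: "(\<Union>n. {exp (- real n)..exp (real n)}) = {0<..}"
  proof (intro equalityI subsetI)
    fix x :: real assume x: "x \<in> {0<..}"
    obtain n where "\<bar>ln x\<bar> \<le> real n" using real_arch_simple by blast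
    then have "- real n \<le> ln x" "ln x \<le> real n" by auto
    then have "exp (- real n) \<le> exp (ln x)" "exp (ln x) \<le> exp (real n)"
      by (simp_all only: exp_le_cancel_iff)
    moreover have "exp (ln x) = x" using x by simp
    ultimately have "x \<in> {exp (- real n)..exp (real n)}" by (simp only: atLeastAtMost_iff)
    then show "x \<in> (\<Union>n. {exp (- real n)..exp (real n)})"
      by blast
  qed (use less_le_trans[OF exp_gt_zero] in auto)
  have V: "(\<Union>n. {- real n..real n}) = UNIV"
  proof -
    have "\<exists>n. - real n \<le> x \<and> x \<le> real n" for x
    proof -
      obtain n where "\<bar>x\<bar> \<le> real n" using real_arch_simple by blast
      then show ?thesis by (intro exI[of _ n]) auto
    qed
    then show ?thesis by auto
  qed
  have "(\<integral>\<^sup>+x. h x * indicator {0<..} x \<partial>lborel)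
      = emeasure (density lborel h) (\<Union>n. {exp (- real n)..exp (real n)})"
    by (simp add: U emeasure_density)
  also have "\<dots> = (SUP n. emeasure (density lborel h) {exp (- real n)..exp (real n)})"
    by (intro SUP_emeasure_incseq[symmetric]) (auto simp: incseq_def intro: order_trans)
  also have "\<dots> = (SUP n. emeasure (density lborel (\<lambda>y. h (exp y) * ennreal (exp y))) {- real n..real n})"
  proof (intro SUP_cong refl)
    fix n :: nat
    have "(\<integral>\<^sup>+x. h x * indicator {exp (- real n)..exp (real n)} x \<partial>lborel)
        = (\<integral>\<^sup>+x. h (exp x) * ennreal (exp x) * indicator {- real n..real n} x \<partial>lborel)"
    \<comment> \<open>For n = 0 both intervals shrink to a point and both integrals vanish; the
      substitution rule is applied only to nondegenerate intervals.\<close>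
    proof (cases "n = 0")
      case True
      have "(\<integral>\<^sup>+x. g x * indicator {c} x \<partial>lborel) = (\<integral>\<^sup>+(x::real). 0 \<partial>lborel)" for g :: "real \<Rightarrow> ennreal" and c
        using AE_lborel_singleton[of c] by (intro nn_integral_cong_AE) (auto elim!: eventually_mono)
      with True show ?thesis by simp
    next
      case False
      then show ?thesis
        by (intro nn_integral_substitution_aux) (auto intro!: derivative_eq_intros continuous_intros)
    qed
    then show "emeasure (density lborel h) {exp (- real n)..exp (real n)}
        = emeasure (density lborel (\<lambda>y. h (exp y) * ennreal (exp y))) {- real n..real n}"
      by (simp add: emeasure_density)
  qed
  also have "\<dots> = emeasure (density lborel (\<lambda>y. h (exp y) * ennreal (exp y))) (\<Union>n. {- real n..real n})"
    by (intro SUP_emeasure_incseq) (auto simp: incseq_def)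
  also have "\<dots> = (\<integral>\<^sup>+y. h (exp y) * ennreal (exp y) \<partial>lborel)"
    by (simp add: V emeasure_density)
  finally show ?thesis .
qed

text \<open>Dilating Euler's integral by c contributes c from the measure and c powr (a - 1) from
  the integrand. Euler's integral is over the closed half-line, hence the passage over the null set
  {0}.\<close>

lemma nn_integral_Gamma_rate:
  fixes a c :: real
  assumes a: "0 < a" and c: "0 < c"
  shows "(\<integral>\<^sup>+s. ennreal (indicator {0<..} s * s powr (a - 1) * exp (- c * s)) \<partial>lborel)
       = ennreal (Gamma a / c powr a)"
proof -
  have "ennreal (Gamma a) = (\<integral>\<^sup>+s. ennreal (indicator {0<..} s * s powr (a - 1) * exp (- s)) \<partial>lborel)"
    unfolding Gamma_conv_nn_integral_real[OF a]
    using AE_lborel_singleton[of "0::real"]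
    by (intro nn_integral_cong_AE) (auto elim!: eventually_mono simp: indicator_def exp_minus field_simps)
  also have "\<dots> = ennreal c * (\<integral>\<^sup>+s. ennreal (indicator {0<..} (c * s) * (c * s) powr (a - 1) * exp (- (c * s))) \<partial>lborel)"
    using c by (subst nn_integral_real_affine[where c = c and t = 0]) auto
  also have "\<dots> = ennreal c * (\<integral>\<^sup>+s. ennreal (c powr (a - 1)) *
      ennreal (indicator {0<..} s * s powr (a - 1) * exp (- c * s)) \<partial>lborel)"
    using c by (intro arg_cong2[where f = "(*)"] nn_integral_cong refl)
       (auto simp: indicator_def zero_less_mult_iff powr_mult ennreal_mult' [symmetric] mult_ac)
  also have "\<dots> = ennreal (c powr a) * (\<integral>\<^sup>+s. ennreal (indicator {0<..} s * s powr (a - 1) * exp (- c * s)) \<partial>lborel)"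
    using c by (subst nn_integral_cmult) (auto simp: mult.assoc[symmetric] ennreal_mult'[symmetric] powr_diff)
  finally have *: "ennreal (Gamma a) = \<dots>" .
  have "ennreal (Gamma a / c powr a) = ennreal (1 / c powr a) * ennreal (Gamma a)"
    using a c by (simp flip: ennreal_mult')
  also have "\<dots> = (\<integral>\<^sup>+s. ennreal (indicator {0<..} s * s powr (a - 1) * exp (- c * s)) \<partial>lborel)"
    unfolding * using c by (simp flip: mult.assoc ennreal_mult')
  finally show ?thesis by simp
qed


section \<open>The independent Gamma sample and its comparison with the Dirichlet prior\<close>

definition gamma_pdf :: "real \<Rightarrow> real \<Rightarrow> real" where
  "gamma_pdf \<alpha> x = indicator {0<..} x * x powr (\<alpha> - 1) * exp (- x) / Gamma \<alpha>"

definition gamma_law :: "real \<Rightarrow> real measure" where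
  "gamma_law \<alpha> = density lborel (\<lambda>x. ennreal (gamma_pdf \<alpha> x))"

definition gamma_sample :: "real \<Rightarrow> nat \<Rightarrow> (nat \<Rightarrow> real) measure" where
  "gamma_sample \<alpha> t = PiM {1..t} (\<lambda>_. gamma_law \<alpha>)"

lemma gamma_pdf_nonneg: "0 < \<alpha> \<Longrightarrow> 0 \<le> gamma_pdf \<alpha> x"
  using Gamma_real_pos[of \<alpha>] by (simp add: gamma_pdf_def)

lemma measurable_gamma_pdf [measurable]: "gamma_pdf \<alpha> \<in> borel_measurable borel"
  unfolding gamma_pdf_def by measurable

lemma sets_gamma_law [measurable_cong, simp]: "sets (gamma_law \<alpha>) = sets borel"
  by (simp add: gamma_law_def)

lemma space_gamma_law [simp]: "space (gamma_law \<alpha>) = UNIV"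
  by (simp add: gamma_law_def)

lemma prob_space_gamma_law:
  assumes "0 < \<alpha>"
  shows "prob_space (gamma_law \<alpha>)"
proof
  have "emeasure (gamma_law \<alpha>) (space (gamma_law \<alpha>)) = (\<integral>\<^sup>+x. ennreal (gamma_pdf \<alpha> x) \<partial>lborel)"
    by (simp add: gamma_law_def emeasure_density)
  also have "\<dots> = (\<integral>\<^sup>+x. ennreal (1 / Gamma \<alpha>) *
      ennreal (indicator {0<..} x * x powr (\<alpha> - 1) * exp (- 1 * x)) \<partial>lborel)"
    using Gamma_real_pos[OF assms]
    by (intro nn_integral_cong) (simp add: gamma_pdf_def flip: ennreal_mult)
  also have "\<dots> = ennreal (1 / Gamma \<alpha>) * ennreal (Gamma \<alpha> / 1 powr \<alpha>)"
    using nn_integral_Gamma_rate[OF assms, of 1] by (simp add: nn_integral_cmult)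
  also have "\<dots> = 1"
    using Gamma_real_pos[OF assms] by (simp flip: ennreal_mult)
  finally show "emeasure (gamma_law \<alpha>) (space (gamma_law \<alpha>)) = 1" .
qed

lemma sets_strength_space [measurable_cong]: "sets (strength_space t) = sets (PiM {1..t} (\<lambda>_. borel))"
  by (simp add: strength_space_def)

lemma sets_gamma_sample: "sets (gamma_sample \<alpha> t) = sets (strength_space t)"
  unfolding gamma_sample_def strength_space_def by (intro sets_PiM_cong) auto

lemma sets_PiM_lborel: "sets (PiM I (\<lambda>_. lborel)) = sets (PiM I (\<lambda>_. borel))"
  by (intro sets_PiM_cong) auto

text \<open>Separates a homogeneous factor supported on positive vectors, which is the Dirichlet
  weight up to the constant Gamma(t \<alpha>), from a factor that depends only on the total.\<close>

lemma prod_gamma_pdf: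
  assumes "0 < \<alpha>"
  shows "(\<Prod>i=1..t. ennreal (gamma_pdf \<alpha> (x i)))
    = (if \<forall>i\<in>{1..t}. 0 < x i then ennreal ((\<Prod>i=1..t. x i powr (\<alpha> - 1)) / Gamma \<alpha> ^ t) else 0)
      * ennreal (exp (- (\<Sum>i=1..t. x i)))"
proof (cases "\<forall>i\<in>{1..t}. 0 < x i")
  case True
  have "(\<Prod>i=1..t. ennreal (gamma_pdf \<alpha> (x i))) = ennreal (\<Prod>i=1..t. gamma_pdf \<alpha> (x i))"
    using gamma_pdf_nonneg[OF assms] by (intro prod_ennreal) auto
  also have "(\<Prod>i=1..t. gamma_pdf \<alpha> (x i)) = (\<Prod>i=1..t. x i powr (\<alpha> - 1) * exp (- x i) / Gamma \<alpha>)"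
    using True by (intro prod.cong) (auto simp: gamma_pdf_def)
  also have "\<dots> = (\<Prod>i=1..t. x i powr (\<alpha> - 1)) / Gamma \<alpha> ^ t * exp (- (\<Sum>i=1..t. x i))"
    by (simp add: prod.distrib prod_dividef exp_sum flip: sum_negf)
  finally show ?thesis
    using True Gamma_real_pos[OF assms]
    by (simp add: prod_nonneg flip: ennreal_mult)
next
  case False
  then obtain i where "i \<in> {1..t}" "\<not> 0 < x i" by blast
  then have "\<exists>i\<in>{1..t}. ennreal (gamma_pdf \<alpha> (x i)) = 0"
    by (intro bexI[of _ i]) (auto simp: gamma_pdf_def)
  then have "(\<Prod>i=1..t. ennreal (gamma_pdf \<alpha> (x i))) = 0"
    by (rule prod_zero[OF finite_atLeastAtMost])
  with False show ?thesis by (simp only: if_False mult_zero_left)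
qed

lemma gamma_sample_eq_density:
  assumes "0 < \<alpha>"
  shows "gamma_sample \<alpha> t = density (PiM {1..t} (\<lambda>_. lborel)) (\<lambda>x. \<Prod>i=1..t. ennreal (gamma_pdf \<alpha> (x i)))"
  unfolding gamma_sample_def gamma_law_def
  using prob_space_imp_sigma_finite[OF prob_space_gamma_law[OF assms]]
  by (intro PiM_density) (auto simp: gamma_law_def sigma_finite_lborel)

interpretation plborel: product_sigma_finite "\<lambda>_::nat. lborel :: real measure"
  by standard

text \<open>The sample is integrated by substituting \<open>x\<^sub>t = r - \<Sum>\<^sub>i\<^sub><\<^sub>t x\<^sub>i\<close> and then \<open>x\<^sub>i = r y\<^sub>i\<close>:
  only translations and dilations are needed, and the total \<open>r\<close> splits off as a Gamma integral.\<close>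

lemma nn_integral_dirichlet_prior_eq_gamma_sample:
  assumes \<alpha>: "0 < \<alpha>" and t: "1 \<le> t"
    and h: "h \<in> borel_measurable (strength_space t)"
    and hom: "\<And>x c. \<lbrakk>0 < c; \<forall>i\<in>{1..t}. 0 < x i\<rbrakk> \<Longrightarrow> h (\<lambda>i\<in>{1..t}. c * x i) = h x"
  shows "(\<integral>\<^sup>+x. h x \<partial>dirichlet_prior \<alpha> t) = (\<integral>\<^sup>+x. h x \<partial>gamma_sample \<alpha> t)"
proof -
  note One_nat_def[simp del]
  have G: "0 < Gamma \<alpha>" "0 < Gamma (real t * \<alpha>)"
    using \<alpha> t by (auto intro!: Gamma_real_pos mult_pos_pos)
  let ?P = "\<lambda>t. PiM {1..t} (\<lambda>_. lborel :: real measure)" and ?Q = "PiM {1..<t} (\<lambda>_. lborel :: real measure)"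
  have hP[measurable]: "h \<in> borel_measurable (?P t)"
    using h by (simp add: strength_space_def measurable_cong_sets[OF sets_PiM_lborel refl])
  have ins: "{1..t} = insert t {1..<t}" using t by auto
  \<comment> \<open>\<open>w\<close> is homogeneous of degree t (\<alpha> - 1): \<open>h\<close> is
    scale invariant on positive vectors, and elsewhere the first factor is 0.\<close>
  define w where "w x = (if \<forall>i\<in>{1..t}. 0 < x i
    then ennreal ((\<Prod>i=1..t. x i powr (\<alpha> - 1)) / Gamma \<alpha> ^ t) else 0) * h x" for x
  have wP[measurable]: "w \<in> borel_measurable (?P t)"
    unfolding w_def by measurable
  have w_hom: "w (\<lambda>i\<in>{1..t}. r * x i) = ennreal (r powr (real t * (\<alpha> - 1))) * w x" if r: "0 < r" for r x
  proof (cases "\<forall>i\<in>{1..t}. 0 < x i")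
    case True
    have "(\<Prod>i=1..t. (r * x i) powr (\<alpha> - 1)) = (\<Prod>i=1..t. r powr (\<alpha> - 1) * x i powr (\<alpha> - 1))"
      using True r by (intro prod.cong refl) (auto simp: powr_mult less_imp_le)
    also have "\<dots> = r powr (real t * (\<alpha> - 1)) * (\<Prod>i=1..t. x i powr (\<alpha> - 1))"
      using r by (simp only: prod.distrib prod_constant card_atLeastAtMost)
         (simp add: powr_powr powr_realpow[symmetric] mult.commute)
    finally have "(\<Prod>i=1..t. (r * x i) powr (\<alpha> - 1)) = \<dots>" .
    moreover have "(\<Prod>i=1..t. ((\<lambda>i\<in>{1..t}. r * x i) i) powr (\<alpha> - 1)) = (\<Prod>i=1..t. (r * x i) powr (\<alpha> - 1))"
      by (intro prod.cong) auto
    ultimately have "ennreal ((\<Prod>i=1..t. ((\<lambda>i\<in>{1..t}. r * x i) i) powr (\<alpha> - 1)) / Gamma \<alpha> ^ t)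
       = ennreal (r powr (real t * (\<alpha> - 1))) * ennreal ((\<Prod>i=1..t. x i powr (\<alpha> - 1)) / Gamma \<alpha> ^ t)"
      by (simp only: ennreal_mult'[symmetric] powr_ge_zero times_divide_eq_right)
    moreover have pos: "\<forall>i\<in>{1..t}. 0 < (\<lambda>i\<in>{1..t}. r * x i) i"
      using True r by simp
    ultimately show ?thesis
      unfolding w_def if_P[OF pos] if_P[OF True] hom[OF r True] by (simp only: mult.assoc)
  next
    case False
    then have "\<not> (\<forall>i\<in>{1..t}. 0 < (\<lambda>i\<in>{1..t}. r * x i) i)"
      using r by (simp add: zero_less_mult_iff)
    with False show ?thesis unfolding w_def by (simp only: if_False mult_zero_left mult_zero_right)
  qed
  have upd[measurable]: "(\<lambda>p. (fst p)(t := snd p)) \<in> measurable (?Q \<Otimes>\<^sub>M lborel) (?P t)"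
    unfolding ins by measurable
  have fib[measurable]: "(\<lambda>p. w ((fst p)(t := snd p - (\<Sum>i=1..<t. fst p i)))) \<in> borel_measurable (?Q \<Otimes>\<^sub>M lborel)"
  proof -
    have "(\<lambda>p. (fst p, snd p - (\<Sum>i=1..<t. fst p i))) \<in> measurable (?Q \<Otimes>\<^sub>M lborel) (?Q \<Otimes>\<^sub>M lborel)"
      by measurable
    from measurable_compose[OF measurable_compose[OF this upd] wP] show ?thesis by simp
  qed
  have fib1[measurable]: "(\<lambda>y. w (y(t := r - (\<Sum>i=1..<t. y i)))) \<in> borel_measurable ?Q" for r
    using measurable_compose[OF measurable_Pair2'[of r lborel] fib] by simp
  define K where "K = (\<integral>\<^sup>+y. w (y(t := 1 - (\<Sum>i=1..<t. y i))) \<partial>?Q)"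
  \<comment> \<open>The vectors of total r are r times those of total 1. The dilation of t - 1
    coordinates gives r^(t - 1) and the homogeneity of \<open>w\<close> gives r powr (t (\<alpha> -
    1)); together this is r powr (t \<alpha> - 1). If r is not positive, no positive vector has
    total r.\<close>
  have slice: "(\<integral>\<^sup>+y. w (y(t := r - (\<Sum>i=1..<t. y i))) \<partial>?Q)
      = ennreal (indicator {0<..} r * r powr (real t * \<alpha> - 1)) * K" for r
  proof (cases "0 < r")
    case r: True
    have "(\<integral>\<^sup>+y. w (y(t := r - (\<Sum>i=1..<t. y i))) \<partial>?Q)
      = ennreal (r ^ (t - 1)) * (\<integral>\<^sup>+y. w ((\<lambda>i\<in>{1..<t}. r * y i)(t := r - (\<Sum>i=1..<t. (\<lambda>i\<in>{1..<t}. r * y i) i))) \<partial>?Q)"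
      using nn_integral_PiM_lborel_scale[OF finite_atLeastLessThan r fib1] by (simp only: card_atLeastLessThan)
    also have "(\<integral>\<^sup>+y. w ((\<lambda>i\<in>{1..<t}. r * y i)(t := r - (\<Sum>i=1..<t. (\<lambda>i\<in>{1..<t}. r * y i) i))) \<partial>?Q)
      = (\<integral>\<^sup>+y. ennreal (r powr (real t * (\<alpha> - 1))) * w (y(t := 1 - (\<Sum>i=1..<t. y i))) \<partial>?Q)"
    proof (rule nn_integral_cong)
      fix y
      have "(\<Sum>i=1..<t. (\<lambda>i\<in>{1..<t}. r * y i) i) = r * (\<Sum>i=1..<t. y i)"
        by (simp add: sum_distrib_left)
      then have "(\<lambda>i\<in>{1..<t}. r * y i)(t := r - (\<Sum>i=1..<t. (\<lambda>i\<in>{1..<t}. r * y i) i))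
        = (\<lambda>i\<in>{1..t}. r * (y(t := 1 - (\<Sum>i=1..<t. y i))) i)"
        using t by (auto simp: fun_eq_iff right_diff_distrib)
      then show "w ((\<lambda>i\<in>{1..<t}. r * y i)(t := r - (\<Sum>i=1..<t. (\<lambda>i\<in>{1..<t}. r * y i) i)))
        = ennreal (r powr (real t * (\<alpha> - 1))) * w (y(t := 1 - (\<Sum>i=1..<t. y i)))"
        using w_hom[OF r] by (simp only:)
    qed
    also have "\<dots> = ennreal (r powr (real t * (\<alpha> - 1))) * K"
      unfolding K_def by (intro nn_integral_cmult) measurable
    also have "ennreal (r ^ (t - 1)) * (ennreal (r powr (real t * (\<alpha> - 1))) * K)
      = ennreal (r powr (real t * \<alpha> - 1)) * K"
    proof -
      have "r ^ (t - 1) * r powr (real t * (\<alpha> - 1)) = r powr (real t * \<alpha> - 1)"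
        using r t by (simp add: powr_realpow[symmetric] powr_add[symmetric] of_nat_diff algebra_simps)
      then show ?thesis using r by (simp add: mult.assoc[symmetric] ennreal_mult'[symmetric])
    qed
    finally show ?thesis using r by (simp add: fun_upd_def)
  next
    case False
    have "w (y(t := r - (\<Sum>i=1..<t. y i))) = 0" for y
    proof -
      have "\<not> (\<forall>i\<in>{1..t}. 0 < (y(t := r - (\<Sum>i=1..<t. y i))) i)"
      proof
        assume *: "\<forall>i\<in>{1..t}. 0 < (y(t := r - (\<Sum>i=1..<t. y i))) i"
        then have "0 < r - (\<Sum>i=1..<t. y i)" using t by (auto dest: bspec[of _ _ t])
        moreover have "0 \<le> (\<Sum>i=1..<t. y i)"
          using * by (intro sum_nonneg) (auto simp: less_imp_le split: if_splits)
        ultimately show False using False by linarith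
      qed
      then show ?thesis unfolding w_def by (simp only: if_False mult_zero_left)
    qed
    with False show ?thesis by simp
  qed
  have "(\<integral>\<^sup>+x. h x \<partial>gamma_sample \<alpha> t)
      = (\<integral>\<^sup>+x. (\<Prod>i=1..t. ennreal (gamma_pdf \<alpha> (x i))) * h x \<partial>?P t)"
    unfolding gamma_sample_eq_density[OF \<alpha>] by (intro nn_integral_density) auto
  also have "\<dots> = (\<integral>\<^sup>+x. w x * ennreal (exp (- (\<Sum>i=1..t. x i))) \<partial>?P t)"
    unfolding w_def prod_gamma_pdf[OF \<alpha>] by (simp only: mult_ac)
  also have "\<dots> = (\<integral>\<^sup>+y. \<integral>\<^sup>+s. w (y(t := s)) * ennreal (exp (- (\<Sum>i=1..t. (y(t := s)) i))) \<partial>lborel \<partial>?Q)"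
  proof -
    have "(\<lambda>x. w x * ennreal (exp (- (\<Sum>i=1..t. x i)))) \<in> borel_measurable (?P t)"
      by measurable
    then show ?thesis
      unfolding ins by (intro plborel.product_nn_integral_insert) auto
  qed
  also have "\<dots> = (\<integral>\<^sup>+y. \<integral>\<^sup>+s. w (y(t := s)) * ennreal (exp (- ((\<Sum>i=1..<t. y i) + s))) \<partial>lborel \<partial>?Q)"
  proof -
    have "(\<Sum>i=1..t. (y(t := s)) i) = (\<Sum>i=1..<t. y i) + s" for y :: "nat \<Rightarrow> real" and s
      unfolding ins by (simp add: add.commute)
    then show ?thesis by (simp only:)
  qed
  also have "\<dots> = (\<integral>\<^sup>+y. \<integral>\<^sup>+r. w (y(t := r - (\<Sum>i=1..<t. y i))) * ennreal (exp (- r)) \<partial>lborel \<partial>?Q)"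
  proof (rule nn_integral_cong)
    fix y assume y: "y \<in> space ?Q"
    have [measurable]: "(\<lambda>s. w (y(t := s))) \<in> borel_measurable borel"
      using measurable_compose[OF measurable_Pair1'[OF y] measurable_compose[OF upd wP]] by simp
    show "(\<integral>\<^sup>+s. w (y(t := s)) * ennreal (exp (- ((\<Sum>i=1..<t. y i) + s))) \<partial>lborel)
      = (\<integral>\<^sup>+r. w (y(t := r - (\<Sum>i=1..<t. y i))) * ennreal (exp (- r)) \<partial>lborel)"
      by (subst nn_integral_real_affine[where c = 1 and t = "- (\<Sum>i=1..<t. y i)"]) auto
  qed
  \<comment> \<open>With the total integrated last, every slice is a multiple of \<open>K\<close>,
    and the remaining integral over r is Gamma(t \<alpha>), the very constant in the Dirichlet
    density.\<close>
  also have "\<dots> = (\<integral>\<^sup>+r. \<integral>\<^sup>+y. w (y(t := r - (\<Sum>i=1..<t. y i))) * ennreal (exp (- r)) \<partial>?Q \<partial>lborel)"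
  proof (rule pair_sigma_finite.Fubini')
    show "pair_sigma_finite lborel ?Q"
      by (intro pair_sigma_finite.intro sigma_finite_lborel plborel.sigma_finite finite_atLeastLessThan)
    show "(\<lambda>(r, y). w (y(t := r - (\<Sum>i=1..<t. y i))) * ennreal (exp (- r))) \<in> borel_measurable (lborel \<Otimes>\<^sub>M ?Q)"
    proof -
      have [measurable]: "(\<lambda>q. w ((snd q)(t := fst q - (\<Sum>i=1..<t. snd q i)))) \<in> borel_measurable (lborel \<Otimes>\<^sub>M ?Q)"
        using measurable_compose[OF measurable_pair_swap' fib] by (simp add: split_beta')
      show ?thesis unfolding split_beta' by measurable
    qed
  qed
  also have "\<dots> = (\<integral>\<^sup>+r. K * ennreal (indicator {0<..} r * r powr (real t * \<alpha> - 1) * exp (- 1 * r)) \<partial>lborel)"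
  proof (rule nn_integral_cong)
    fix r
    show "(\<integral>\<^sup>+y. w (y(t := r - (\<Sum>i=1..<t. y i))) * ennreal (exp (- r)) \<partial>?Q)
       = K * ennreal (indicator {0<..} r * r powr (real t * \<alpha> - 1) * exp (- 1 * r))"
      by (subst nn_integral_multc) (simp_all add: slice ennreal_mult mult_ac)
  qed
  also have "\<dots> = K * ennreal (Gamma (real t * \<alpha>))"
    using nn_integral_Gamma_rate[of "real t * \<alpha>" 1] \<alpha> t by (subst nn_integral_cmult) auto
  finally have gs: "(\<integral>\<^sup>+x. h x \<partial>gamma_sample \<alpha> t) = \<dots>" .

  define D where "D x = ennreal (Gamma (real t * \<alpha>) / Gamma \<alpha> ^ t * (\<Prod>i=1..t. x i powr (\<alpha> - 1)))
             * indicator {x. \<forall>i\<in>{1..t}. 0 < x i} x" for x :: "nat \<Rightarrow> real"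
  have D: "D x = (if \<forall>i\<in>{1..t}. 0 < x i then ennreal (Gamma (real t * \<alpha>)) *
      ennreal ((\<Prod>i=1..t. x i powr (\<alpha> - 1)) / Gamma \<alpha> ^ t) else 0)" for x
    using G by (auto simp: D_def indicator_def ennreal_mult'[symmetric])
  have Dh: "D x * h x = w x * ennreal (Gamma (real t * \<alpha>))" for x
    unfolding D w_def by (simp add: mult_ac)
  have [measurable]: "D \<in> borel_measurable (PiM {1..t} (\<lambda>_. borel))"
    unfolding D by measurable
  have [measurable]: "h \<in> borel_measurable (PiM {1..t} (\<lambda>_. borel))"
    using h by (simp add: strength_space_def)
  have [measurable]: "(\<lambda>y. y(t := 1 - (\<Sum>i=1..<t. y i))) \<in> measurable ?Q (strength_space t)"
    unfolding strength_space_def ins by measurable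
  have "(\<integral>\<^sup>+x. h x \<partial>dirichlet_prior \<alpha> t) = (\<integral>\<^sup>+x. D x * h x \<partial>delta_sum_one t)"
    unfolding dirichlet_prior_def D_def[symmetric]
    by (intro nn_integral_density) (auto simp: delta_sum_one_def)
  also have "\<dots> = (\<integral>\<^sup>+y. D (y(t := 1 - (\<Sum>i=1..<t. y i))) * h (y(t := 1 - (\<Sum>i=1..<t. y i))) \<partial>?Q)"
    unfolding delta_sum_one_def by (intro nn_integral_distr) auto
  also have "\<dots> = K * ennreal (Gamma (real t * \<alpha>))"
    unfolding Dh K_def
    by (intro nn_integral_multc fib1)
  finally show ?thesis using gs by simp
qed


section \<open>The law of the log ratios of the sample\<close>

text \<open>Here s stands for a fixed value of x_t. Substituting x = exp u and then u = ln s + y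
  brings in the factor x = s exp y, which raises the exponent from \<alpha> - 1 to \<alpha>.\<close>

lemma distr_gamma_law_ln:
  assumes \<alpha>: "0 < \<alpha>" and s: "0 < s"
  shows "distr (gamma_law \<alpha>) lborel (\<lambda>x. ln x - ln s)
    = density lborel (\<lambda>y. ennreal ((s * exp y) powr \<alpha> * exp (- (s * exp y)) / Gamma \<alpha>))"
proof (rule measure_eqI)
  fix A assume "A \<in> sets (distr (gamma_law \<alpha>) lborel (\<lambda>x. ln x - ln s))"
  then have A[measurable]: "A \<in> sets borel" by simp
  have [measurable]: "(\<lambda>x. ln x - ln s) \<in> measurable (gamma_law \<alpha>) lborel"
    by measurable
  have "emeasure (distr (gamma_law \<alpha>) lborel (\<lambda>x. ln x - ln s)) A
      = (\<integral>\<^sup>+x. indicator A x \<partial>distr (gamma_law \<alpha>) lborel (\<lambda>x. ln x - ln s))"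
    by simp
  also have "\<dots> = (\<integral>\<^sup>+x. indicator A (ln x - ln s) \<partial>gamma_law \<alpha>)"
    by (intro nn_integral_distr) auto
  also have "\<dots> = (\<integral>\<^sup>+x. ennreal (gamma_pdf \<alpha> x) * indicator A (ln x - ln s) \<partial>lborel)"
    unfolding gamma_law_def by (intro nn_integral_density) auto
  also have "\<dots> = (\<integral>\<^sup>+x. ennreal (gamma_pdf \<alpha> x) * indicator A (ln x - ln s) * indicator {0<..} x \<partial>lborel)"
    by (intro nn_integral_cong) (auto simp: gamma_pdf_def indicator_def)
  also have "\<dots> = (\<integral>\<^sup>+u. ennreal (gamma_pdf \<alpha> (exp u)) * indicator A (u - ln s) * ennreal (exp u) \<partial>lborel)"
    by (subst nn_integral_exp_substitution) auto
  also have "\<dots> = (\<integral>\<^sup>+y. ennreal (gamma_pdf \<alpha> (exp (ln s + y))) * indicator A y * ennreal (exp (ln s + y)) \<partial>lborel)"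
    by (subst nn_integral_real_affine[where c = 1 and t = "ln s"]) auto
  also have "\<dots> = (\<integral>\<^sup>+y. ennreal ((s * exp y) powr \<alpha> * exp (- (s * exp y)) / Gamma \<alpha>) * indicator A y \<partial>lborel)"
  proof (rule nn_integral_cong)
    fix y
    have "gamma_pdf \<alpha> (s * exp y) * (s * exp y) = (s * exp y) powr \<alpha> * exp (- (s * exp y)) / Gamma \<alpha>"
      using s by (simp add: gamma_pdf_def powr_diff)
    then have "ennreal (gamma_pdf \<alpha> (s * exp y)) * ennreal (s * exp y)
       = ennreal ((s * exp y) powr \<alpha> * exp (- (s * exp y)) / Gamma \<alpha>)"
      using s gamma_pdf_nonneg[OF \<alpha>] by (simp flip: ennreal_mult)
    then show "ennreal (gamma_pdf \<alpha> (exp (ln s + y))) * indicator A y * ennreal (exp (ln s + y))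
      = ennreal ((s * exp y) powr \<alpha> * exp (- (s * exp y)) / Gamma \<alpha>) * indicator A y"
      using s by (simp add: exp_add mult_ac)
  qed
  also have "\<dots> = emeasure (density lborel (\<lambda>y. ennreal ((s * exp y) powr \<alpha> * exp (- (s * exp y)) / Gamma \<alpha>))) A"
    by (simp add: emeasure_density)
  finally show "emeasure (distr (gamma_law \<alpha>) lborel (\<lambda>x. ln x - ln s)) A = \<dots>" .
qed simp

text \<open>With \<gamma>_t = 0, whence the summand 1, and p_i = exp \<gamma>_i / sum_j exp
  \<gamma>_j, this is Gamma(t \<alpha>) / Gamma(\<alpha>)^t times the product of all p_i powr
  \<alpha>. The exponent is \<alpha> rather than \<alpha> - 1 because the Jacobian of \<gamma> -> p
  is the product of the p_i.\<close>

definition dirichlet_gamma_density :: "real \<Rightarrow> nat \<Rightarrow> (nat \<Rightarrow> real) \<Rightarrow> real" where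
  "dirichlet_gamma_density \<alpha> t \<gamma> = Gamma (real t * \<alpha>) / Gamma \<alpha> ^ t
     * exp (\<alpha> * (\<Sum>i=1..<t. \<gamma> i)) / (1 + (\<Sum>i=1..<t. exp (\<gamma> i))) powr (real t * \<alpha>)"

lemma measurable_dirichlet_gamma_density [measurable]:
  "dirichlet_gamma_density \<alpha> t \<in> borel_measurable (gamma_space t)"
  unfolding dirichlet_gamma_density_def gamma_space_def by measurable

lemma measurable_gamma_of [measurable]:
  assumes "1 \<le> t"
  shows "gamma_of t \<in> measurable (strength_space t) (gamma_space t)"
proof -
  have [measurable]: "(\<lambda>x. x t) \<in> borel_measurable (strength_space t)"
    using assms unfolding strength_space_def by (intro measurable_component_singleton) simp
  have [measurable]: "(\<lambda>x. x i) \<in> borel_measurable (strength_space t)" if "i \<in> {1..<t}" for i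
    using that unfolding strength_space_def by (intro measurable_component_singleton) simp
  show ?thesis
    unfolding gamma_of_def gamma_space_def by measurable
qed

lemma distr_gamma_sample_gamma_of:
  assumes \<alpha>: "0 < \<alpha>" and t: "1 \<le> t"
  shows "distr (gamma_sample \<alpha> t) (gamma_space t) (gamma_of t)
    = density (gamma_space t) (\<lambda>\<gamma>. ennreal (dirichlet_gamma_density \<alpha> t \<gamma>))"
proof (rule measure_eqI)
  note One_nat_def[simp del]
  fix A assume "A \<in> sets (distr (gamma_sample \<alpha> t) (gamma_space t) (gamma_of t))"
  then have A[measurable]: "A \<in> sets (gamma_space t)" by simp
  have ins: "{1..t} = insert t {1..<t}" using t by auto
  let ?Q = "PiM {1..<t} (\<lambda>_. lborel :: real measure)"
  have Q: "gamma_space t = ?Q" by (simp add: gamma_space_def)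
  have A'[measurable]: "A \<in> sets ?Q" using A by (simp only: Q)
  interpret G: product_prob_space "\<lambda>_. gamma_law \<alpha>" "{1..t}"
    by (intro product_prob_spaceI prob_space_gamma_law \<alpha>)
  have go[measurable]: "gamma_of t \<in> measurable (gamma_sample \<alpha> t) (gamma_space t)"
    using measurable_gamma_of[OF t] by (simp add: measurable_cong_sets[OF sets_gamma_sample refl])
  define k where "k s y = (s * exp y) powr \<alpha> * exp (- (s * exp y)) / Gamma \<alpha>" for s y :: real
  have k[measurable]: "case_prod k \<in> borel_measurable (borel \<Otimes>\<^sub>M borel)"
    unfolding k_def by measurable
  have k_nonneg: "0 \<le> k s y" if "0 < s" for s y
    using Gamma_real_pos[OF \<alpha>] by (simp add: k_def)
  \<comment> \<open>Once x_t = s is fixed, each coordinate of \<open>gamma_of\<close> depends on one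
    x_i only, so its law is a product with marginal densities \<open>k s\<close>.\<close>
  have slice: "(\<integral>\<^sup>+x. indicator A (gamma_of t (x(t := s))) \<partial>PiM {1..<t} (\<lambda>_. gamma_law \<alpha>))
      = (\<integral>\<^sup>+\<gamma>. (\<Prod>i=1..<t. ennreal (k s (\<gamma> i))) * indicator A \<gamma> \<partial>?Q)" if s: "0 < s" for s
  proof -
    have g: "gamma_of t (x(t := s)) = (\<lambda>i\<in>{1..<t}. ln (x i) - ln s)" for x
      by (auto simp: gamma_of_def)
    have [measurable]: "(\<lambda>x. \<lambda>i\<in>{1..<t}. ln (x i) - ln s) \<in> measurable (PiM {1..<t} (\<lambda>_. gamma_law \<alpha>)) ?Q"
      by measurable
    have kfin: "sigma_finite_measure (density lborel (\<lambda>y. ennreal (k s y)))"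
      by (subst sigma_finite_measure.sigma_finite_iff_density_finite) (auto simp: sigma_finite_lborel)
    have "(\<integral>\<^sup>+x. indicator A (gamma_of t (x(t := s))) \<partial>PiM {1..<t} (\<lambda>_. gamma_law \<alpha>))
      = (\<integral>\<^sup>+\<gamma>. indicator A \<gamma> \<partial>distr (PiM {1..<t} (\<lambda>_. gamma_law \<alpha>)) ?Q (\<lambda>x. \<lambda>i\<in>{1..<t}. ln (x i) - ln s))"
      unfolding g by (rule nn_integral_distr[symmetric]) measurable
    also have "distr (PiM {1..<t} (\<lambda>_. gamma_law \<alpha>)) ?Q (\<lambda>x. \<lambda>i\<in>{1..<t}. ln (x i) - ln s)
      = PiM {1..<t} (\<lambda>_. distr (gamma_law \<alpha>) lborel (\<lambda>x. ln x - ln s))"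
      using kfin prob_space_imp_sigma_finite[OF prob_space_gamma_law[OF \<alpha>]]
      by (intro distr_PiM_componentwise) (auto simp: distr_gamma_law_ln[OF \<alpha> s] k_def)
    also have "\<dots> = PiM {1..<t} (\<lambda>_. density lborel (\<lambda>y. ennreal (k s y)))"
      by (simp add: distr_gamma_law_ln[OF \<alpha> s] k_def)
    also have "\<dots> = density ?Q (\<lambda>\<gamma>. \<Prod>i=1..<t. ennreal (k s (\<gamma> i)))"
      using kfin by (intro PiM_density) (auto simp: sigma_finite_lborel)
    also have "(\<integral>\<^sup>+\<gamma>. indicator A \<gamma> \<partial>density ?Q (\<lambda>\<gamma>. \<Prod>i=1..<t. ennreal (k s (\<gamma> i))))
      = (\<integral>\<^sup>+\<gamma>. (\<Prod>i=1..<t. ennreal (k s (\<gamma> i))) * indicator A \<gamma> \<partial>?Q)"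
      by (intro nn_integral_density) auto
    finally show ?thesis .
  qed
  \<comment> \<open>The powers of s are \<alpha> - 1 from x_t and \<alpha> from each of t - 1
    ratios, in all t \<alpha> - 1. The exponential rates 1 and exp \<gamma>_i add up to
    \<open>S\<close>, so a Gamma integral of rate \<open>S\<close> remains.\<close>
  have mix: "(\<integral>\<^sup>+s. ennreal (gamma_pdf \<alpha> s) * (\<Prod>i=1..<t. ennreal (k s (\<gamma> i))) \<partial>lborel)
      = ennreal (dirichlet_gamma_density \<alpha> t \<gamma>)" for \<gamma>
  proof -
    define S where "S = 1 + (\<Sum>i=1..<t. exp (\<gamma> i))"
    have S: "0 < S" unfolding S_def by (intro add_pos_nonneg sum_nonneg) auto
    define c where "c = exp (\<alpha> * (\<Sum>i=1..<t. \<gamma> i)) / Gamma \<alpha> ^ t"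
    have c: "0 \<le> c" using Gamma_real_pos[OF \<alpha>] by (simp add: c_def)
    have "ennreal (gamma_pdf \<alpha> s) * (\<Prod>i=1..<t. ennreal (k s (\<gamma> i)))
      = ennreal c * ennreal (indicator {0<..} s * s powr (real t * \<alpha> - 1) * exp (- S * s))" for s
    proof (cases "0 < s")
      case s: True
      have "(\<Prod>i=1..<t. k s (\<gamma> i)) = (\<Prod>i=1..<t. s powr \<alpha> / Gamma \<alpha> * exp (\<alpha> * \<gamma> i) * exp (- s * exp (\<gamma> i)))"
        unfolding k_def using s by (intro prod.cong) (auto simp: powr_mult exp_powr_real mult_ac)
      also have "\<dots> = (s powr \<alpha> / Gamma \<alpha>) ^ (t - 1) * exp (\<alpha> * (\<Sum>i=1..<t. \<gamma> i)) * exp (- s * (S - 1))"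
      proof -
        have "exp (\<alpha> * (\<Sum>i=1..<t. \<gamma> i)) = (\<Prod>i=1..<t. exp (\<alpha> * \<gamma> i))"
          by (simp add: exp_sum sum_distrib_left)
        moreover have "exp (- s * (S - 1)) = (\<Prod>i=1..<t. exp (- s * exp (\<gamma> i)))"
          by (simp add: S_def sum_distrib_left flip: exp_sum)
        ultimately show ?thesis by (simp only: prod.distrib prod_constant card_atLeastLessThan)
      qed
      finally have "gamma_pdf \<alpha> s * (\<Prod>i=1..<t. k s (\<gamma> i))
        = (s powr (\<alpha> - 1) * (s powr \<alpha>) ^ (t - 1)) * (exp (- s) * exp (- s * (S - 1)))
          * exp (\<alpha> * (\<Sum>i=1..<t. \<gamma> i)) / (Gamma \<alpha> * Gamma \<alpha> ^ (t - 1))"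
        using s by (simp add: gamma_pdf_def power_divide)
      also have "s powr (\<alpha> - 1) * (s powr \<alpha>) ^ (t - 1) = s powr (real t * \<alpha> - 1)"
        using s t by (simp add: powr_power powr_add[symmetric] of_nat_diff algebra_simps)
      also have "exp (- s) * exp (- s * (S - 1)) = exp (- S * s)"
        by (simp add: exp_add[symmetric] algebra_simps)
      also have "Gamma \<alpha> * Gamma \<alpha> ^ (t - 1) = Gamma \<alpha> ^ t"
        using t by (simp flip: power_Suc)
      finally have "gamma_pdf \<alpha> s * (\<Prod>i=1..<t. k s (\<gamma> i)) = c * (s powr (real t * \<alpha> - 1) * exp (- S * s))"
        by (simp add: c_def)
      then show ?thesis
        using s k_nonneg[OF s] gamma_pdf_nonneg[OF \<alpha>] c
        by (simp add: prod_ennreal prod_nonneg flip: ennreal_mult)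
    qed (simp add: gamma_pdf_def)
    then have "(\<integral>\<^sup>+s. ennreal (gamma_pdf \<alpha> s) * (\<Prod>i=1..<t. ennreal (k s (\<gamma> i))) \<partial>lborel)
      = ennreal c * (\<integral>\<^sup>+s. ennreal (indicator {0<..} s * s powr (real t * \<alpha> - 1) * exp (- S * s)) \<partial>lborel)"
      by (simp add: nn_integral_cmult)
    also have "\<dots> = ennreal c * ennreal (Gamma (real t * \<alpha>) / S powr (real t * \<alpha>))"
      using \<alpha> t S by (subst nn_integral_Gamma_rate) auto
    also have "\<dots> = ennreal (dirichlet_gamma_density \<alpha> t \<gamma>)"
      using c by (simp add: ennreal_mult'[symmetric] c_def S_def dirichlet_gamma_density_def mult_ac)
    finally show ?thesis .
  qed
  have "emeasure (distr (gamma_sample \<alpha> t) (gamma_space t) (gamma_of t)) A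
      = (\<integral>\<^sup>+\<gamma>. indicator A \<gamma> \<partial>distr (gamma_sample \<alpha> t) (gamma_space t) (gamma_of t))"
    using A by simp
  also have "\<dots> = (\<integral>\<^sup>+x. indicator A (gamma_of t x) \<partial>gamma_sample \<alpha> t)"
    by (intro nn_integral_distr) auto
  also have "\<dots> = (\<integral>\<^sup>+s. \<integral>\<^sup>+x. indicator A (gamma_of t (x(t := s))) \<partial>PiM {1..<t} (\<lambda>_. gamma_law \<alpha>) \<partial>gamma_law \<alpha>)"
  proof -
    have "(\<lambda>x. indicator A (gamma_of t x) :: ennreal) \<in> borel_measurable (gamma_sample \<alpha> t)"
      by measurable
    then show ?thesis
      unfolding gamma_sample_def ins by (intro G.product_nn_integral_insert_rev) auto
  qed
  also have "\<dots> = (\<integral>\<^sup>+s. ennreal (gamma_pdf \<alpha> s) *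
      (\<integral>\<^sup>+x. indicator A (gamma_of t (x(t := s))) \<partial>PiM {1..<t} (\<lambda>_. gamma_law \<alpha>)) \<partial>lborel)"
  proof -
    have "(\<lambda>p. (snd p)(t := fst p)) \<in> measurable (borel \<Otimes>\<^sub>M PiM {1..<t} (\<lambda>_. gamma_law \<alpha>)) (gamma_sample \<alpha> t)"
      unfolding gamma_sample_def ins by measurable
    then have [measurable]: "(\<lambda>(s, x). indicator A (gamma_of t (x(t := s))) :: ennreal)
        \<in> borel_measurable (borel \<Otimes>\<^sub>M PiM {1..<t} (\<lambda>_. gamma_law \<alpha>))"
      unfolding split_beta' by measurable
    have "(\<lambda>s. \<integral>\<^sup>+x. indicator A (gamma_of t (x(t := s))) \<partial>PiM {1..<t} (\<lambda>_. gamma_law \<alpha>)) \<in> borel_measurable borel"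
      by (rule sigma_finite_measure.borel_measurable_nn_integral
            [OF prob_space_imp_sigma_finite[OF prob_space_PiM[OF prob_space_gamma_law[OF \<alpha>]]]]) measurable
    then show ?thesis
      unfolding gamma_law_def[of \<alpha>] by (intro nn_integral_density) (auto simp: gamma_law_def[symmetric])
  qed
  also have "\<dots> = (\<integral>\<^sup>+s. \<integral>\<^sup>+\<gamma>. ennreal (gamma_pdf \<alpha> s) * (\<Prod>i=1..<t. ennreal (k s (\<gamma> i))) * indicator A \<gamma> \<partial>?Q \<partial>lborel)"
  proof (rule nn_integral_cong)
    fix s
    show "ennreal (gamma_pdf \<alpha> s) * (\<integral>\<^sup>+x. indicator A (gamma_of t (x(t := s))) \<partial>PiM {1..<t} (\<lambda>_. gamma_law \<alpha>))
      = (\<integral>\<^sup>+\<gamma>. ennreal (gamma_pdf \<alpha> s) * (\<Prod>i=1..<t. ennreal (k s (\<gamma> i))) * indicator A \<gamma> \<partial>?Q)"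
      by (cases "0 < s") (simp_all add: slice gamma_pdf_def nn_integral_cmult mult.assoc)
  qed
  also have "\<dots> = (\<integral>\<^sup>+\<gamma>. \<integral>\<^sup>+s. ennreal (gamma_pdf \<alpha> s) * (\<Prod>i=1..<t. ennreal (k s (\<gamma> i))) * indicator A \<gamma> \<partial>lborel \<partial>?Q)"
  proof (rule pair_sigma_finite.Fubini')
    show "pair_sigma_finite ?Q lborel"
      by (intro pair_sigma_finite.intro sigma_finite_lborel plborel.sigma_finite finite_atLeastLessThan)
  qed measurable
  also have "\<dots> = (\<integral>\<^sup>+\<gamma>. ennreal (dirichlet_gamma_density \<alpha> t \<gamma>) * indicator A \<gamma> \<partial>?Q)"
    by (intro nn_integral_cong) (simp add: nn_integral_multc mix)
  also have "\<dots> = emeasure (density (gamma_space t) (\<lambda>\<gamma>. ennreal (dirichlet_gamma_density \<alpha> t \<gamma>))) A"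
    by (simp add: emeasure_density Q[symmetric])
  finally show "emeasure (distr (gamma_sample \<alpha> t) (gamma_space t) (gamma_of t)) A = \<dots>" .
qed simp


section \<open>Transfer to the Dirichlet prior: exchange, elimination, normalizability\<close>

lemma sets_dirichlet_prior [simp]: "sets (dirichlet_prior \<alpha> t) = sets (strength_space t)"
  by (simp add: dirichlet_prior_def delta_sum_one_def)

text \<open>The indicator of a set composed with \<open>T\<close> inherits the scale invariance of
  \<open>T\<close>, so the integral identity applies to it.\<close>

lemma distr_dirichlet_prior_eq_gamma_sample:
  assumes \<alpha>: "0 < \<alpha>" and t: "1 \<le> t"
    and T: "T \<in> measurable (strength_space t) N"
    and hom: "\<And>x c. \<lbrakk>0 < c; \<forall>i\<in>{1..t}. 0 < x i\<rbrakk> \<Longrightarrow> T (\<lambda>i\<in>{1..t}. c * x i) = T x"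
  shows "distr (dirichlet_prior \<alpha> t) N T = distr (gamma_sample \<alpha> t) N T"
proof (rule measure_eqI)
  fix A assume "A \<in> sets (distr (dirichlet_prior \<alpha> t) N T)"
  then have A[measurable]: "A \<in> sets N" by simp
  note T[measurable]
  have TD: "T \<in> measurable (dirichlet_prior \<alpha> t) N" and TG: "T \<in> measurable (gamma_sample \<alpha> t) N"
    using T by (simp_all add: measurable_cong_sets[OF sets_dirichlet_prior refl] measurable_cong_sets[OF sets_gamma_sample refl])
  have "emeasure (distr (dirichlet_prior \<alpha> t) N T) A = (\<integral>\<^sup>+x. indicator A (T x) \<partial>dirichlet_prior \<alpha> t)"
    using TD by (simp add: nn_integral_distr flip: nn_integral_indicator)
  also have "\<dots> = (\<integral>\<^sup>+x. indicator A (T x) \<partial>gamma_sample \<alpha> t)"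
    by (intro nn_integral_dirichlet_prior_eq_gamma_sample[OF \<alpha> t]) (measurable, simp only: hom)
  also have "\<dots> = emeasure (distr (gamma_sample \<alpha> t) N T) A"
    using TG by (simp add: nn_integral_distr flip: nn_integral_indicator)
  finally show "emeasure (distr (dirichlet_prior \<alpha> t) N T) A = \<dots>" .
qed simp

text \<open>The term ln c cancels in each difference. Positivity matters: since
  \<open>ln 0 = 0\<close>, a zero entry would not pick up ln c.\<close>

lemma gamma_of_scale:
  assumes "1 \<le> t" "0 < c" "\<forall>i\<in>{1..t}. 0 < x i"
  shows "gamma_of t (\<lambda>i\<in>{1..t}. c * x i) = gamma_of t x"
  using assms unfolding gamma_of_def by (intro restrict_ext) (auto simp: ln_mult_pos)

lemma induces_density_dirichlet_prior:
  assumes \<alpha>: "0 < \<alpha>" and t: "1 \<le> t"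
  shows "induces_density t (dirichlet_prior \<alpha> t) (\<lambda>\<gamma>. ennreal (dirichlet_gamma_density \<alpha> t \<gamma>))"
  unfolding induces_density_def distributed_def
proof (intro conjI)
  show "distr (dirichlet_prior \<alpha> t) (gamma_space t) (gamma_of t)
    = density (gamma_space t) (\<lambda>\<gamma>. ennreal (dirichlet_gamma_density \<alpha> t \<gamma>))"
    using distr_dirichlet_prior_eq_gamma_sample[OF \<alpha> t measurable_gamma_of[OF t] gamma_of_scale[OF t]]
      distr_gamma_sample_gamma_of[OF \<alpha> t] by simp
  show "gamma_of t \<in> measurable (dirichlet_prior \<alpha> t) (gamma_space t)"
    using measurable_gamma_of[OF t] by (simp add: measurable_cong_sets[OF sets_dirichlet_prior refl])
qed measurable

text \<open>Serves exchange, with \<sigma> a transposition and t' = t, and elimination, with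
  \<sigma> the inclusion of {1..t - 1}.\<close>

lemma induces_density_dirichlet_prior_reindex:
  assumes \<alpha>: "0 < \<alpha>" and t: "1 \<le> t'" "1 \<le> t"
    and inj: "inj_on \<sigma> {1..t'}" and \<sigma>: "\<sigma> \<in> {1..t'} \<rightarrow> {1..t}"
  shows "induces_density t' (distr (dirichlet_prior \<alpha> t) (strength_space t') (\<lambda>x. \<lambda>k\<in>{1..t'}. x (\<sigma> k)))
    (\<lambda>\<gamma>. ennreal (dirichlet_gamma_density \<alpha> t' \<gamma>))"
  unfolding induces_density_def distributed_def
proof (intro conjI)
  let ?R = "\<lambda>x::nat \<Rightarrow> real. \<lambda>k\<in>{1..t'}. x (\<sigma> k)"
  interpret G: product_prob_space "\<lambda>_. gamma_law \<alpha>" "{1..t}"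
    by (intro product_prob_spaceI prob_space_gamma_law \<alpha>)
  have R: "?R \<in> measurable (strength_space t) (strength_space t')"
    unfolding strength_space_def using \<sigma> by (intro measurable_restrict measurable_component_singleton) auto
  have go: "gamma_of t' \<in> measurable (strength_space t') (gamma_space t')"
    by (rule measurable_gamma_of[OF t(1)])
  have RD: "?R \<in> measurable (dirichlet_prior \<alpha> t) (strength_space t')"
    and RG: "?R \<in> measurable (gamma_sample \<alpha> t) (strength_space t')"
    using R by (simp_all add: measurable_cong_sets[OF sets_dirichlet_prior refl] measurable_cong_sets[OF sets_gamma_sample refl])
  \<comment> \<open>Distinct entries of an independent, identically distributed family form such a
    family again; injectivity of \<sigma> enters here.\<close>
  have RGG: "distr (gamma_sample \<alpha> t) (strength_space t') ?R = gamma_sample \<alpha> t'"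
    using G.distr_reorder[OF inj \<sigma>] distr_cong[OF refl sets_gamma_sample refl, of "gamma_sample \<alpha> t" \<alpha> t' ?R]
    by (simp add: gamma_sample_def)
  have "distr (distr (dirichlet_prior \<alpha> t) (strength_space t') ?R) (gamma_space t') (gamma_of t')
      = distr (dirichlet_prior \<alpha> t) (gamma_space t') (gamma_of t' \<circ> ?R)"
    by (rule distr_distr[OF go RD])
  \<comment> \<open>\<open>?R\<close> alone commutes with scaling but is not invariant under it, so
    the transfer is made for the composite.\<close>
  also have "\<dots> = distr (gamma_sample \<alpha> t) (gamma_space t') (gamma_of t' \<circ> ?R)"
  proof (rule distr_dirichlet_prior_eq_gamma_sample[OF \<alpha> t(2)])
    show "gamma_of t' \<circ> ?R \<in> measurable (strength_space t) (gamma_space t')"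
      by (rule measurable_comp[OF R go])
    fix x :: "nat \<Rightarrow> real" and c :: real
    assume c: "0 < c" and x: "\<forall>i\<in>{1..t}. 0 < x i"
    have "?R (\<lambda>i\<in>{1..t}. c * x i) = (\<lambda>k\<in>{1..t'}. c * ?R x k)"
      using \<sigma> by (intro restrict_ext) (auto simp: Pi_iff)
    moreover have "\<forall>k\<in>{1..t'}. 0 < ?R x k"
      using x \<sigma> by (auto simp: Pi_iff)
    ultimately show "(gamma_of t' \<circ> ?R) (\<lambda>i\<in>{1..t}. c * x i) = (gamma_of t' \<circ> ?R) x"
      using gamma_of_scale[OF t(1) c] by (simp only: comp_apply)
  qed
  also have "\<dots> = distr (distr (gamma_sample \<alpha> t) (strength_space t') ?R) (gamma_space t') (gamma_of t')"
    by (rule distr_distr[OF go RG, symmetric])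
  also have "\<dots> = density (gamma_space t') (\<lambda>\<gamma>. ennreal (dirichlet_gamma_density \<alpha> t' \<gamma>))"
    unfolding RGG by (rule distr_gamma_sample_gamma_of[OF \<alpha> t(1)])
  finally show "distr (distr (dirichlet_prior \<alpha> t) (strength_space t') ?R) (gamma_space t') (gamma_of t') = \<dots>" .
  show "gamma_of t' \<in> measurable (distr (dirichlet_prior \<alpha> t) (strength_space t') ?R) (gamma_space t')"
    using go by simp
qed measurable

lemma team_interchange_invariant_dirichlet_prior:
  assumes \<alpha>: "0 < \<alpha>" and t: "1 \<le> t"
  shows "team_interchange_invariant t (dirichlet_prior \<alpha> t)"
  unfolding team_interchange_invariant_def prior_equiv_def
proof (intro ballI impI exI conjI)
  fix i j assume ij: "i \<in> {1..t}" "j \<in> {1..t}"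
  show "induces_density t (distr (dirichlet_prior \<alpha> t) (strength_space t)
      (\<lambda>\<pi>. \<lambda>k\<in>{1..t}. \<pi> (Transposition.transpose i j k))) (\<lambda>\<gamma>. ennreal (dirichlet_gamma_density \<alpha> t \<gamma>))"
    using ij by (intro induces_density_dirichlet_prior_reindex \<alpha> t) (auto simp: Transposition.transpose_def inj_on_def)
qed (auto intro: induces_density_dirichlet_prior \<alpha> t)

lemma elimination_invariant_dirichlet_prior:
  assumes \<alpha>: "0 < \<alpha>"
  shows "elimination_invariant (dirichlet_prior \<alpha>)"
  unfolding elimination_invariant_def prior_equiv_def
proof (intro allI impI exI conjI)
  fix t :: nat assume t: "2 < t"
  show "induces_density (t - 1) (distr (dirichlet_prior \<alpha> t) (strength_space (t - 1)) (\<lambda>\<pi>. restrict \<pi> {1..t - 1}))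
      (\<lambda>\<gamma>. ennreal (dirichlet_gamma_density \<alpha> (t - 1) \<gamma>))"
    using t by (intro induces_density_dirichlet_prior_reindex \<alpha>) auto
  show "induces_density (t - 1) (dirichlet_prior \<alpha> (t - 1)) (\<lambda>\<gamma>. ennreal (dirichlet_gamma_density \<alpha> (t - 1) \<gamma>))"
    using t by (intro induces_density_dirichlet_prior \<alpha>) auto
qed simp

text \<open>The integral of the density is the total mass of an image of the sample, a probability
  measure; thus c = 1 serves without evaluating the integral.\<close>

lemma normalizable_dirichlet_prior:
  assumes \<alpha>: "0 < \<alpha>" and t: "1 \<le> t"
  shows "normalizable t (dirichlet_prior \<alpha> t)"
proof -
  interpret G: product_prob_space "\<lambda>_. gamma_law \<alpha>" "{1..t}"
    by (intro product_prob_spaceI prob_space_gamma_law \<alpha>)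
  have go: "gamma_of t \<in> measurable (gamma_sample \<alpha> t) (gamma_space t)"
    using measurable_gamma_of[OF t] by (simp add: measurable_cong_sets[OF sets_gamma_sample refl])
  have "(\<integral>\<^sup>+\<gamma>. ennreal (dirichlet_gamma_density \<alpha> t \<gamma>) \<partial>gamma_space t)
      = emeasure (density (gamma_space t) (\<lambda>\<gamma>. ennreal (dirichlet_gamma_density \<alpha> t \<gamma>))) (space (gamma_space t))"
    by (subst emeasure_density) (auto intro!: nn_integral_cong)
  also have "\<dots> = emeasure (distr (gamma_sample \<alpha> t) (gamma_space t) (gamma_of t)) (space (gamma_space t))"
    by (simp add: distr_gamma_sample_gamma_of[OF \<alpha> t])
  also have "\<dots> = 1"
    using prob_space.emeasure_space_1[OF prob_space.prob_space_distr[OF _ go]] G.P.prob_space_axioms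
    by (simp add: gamma_sample_def)
  finally show ?thesis
    unfolding normalizable_def
    using induces_density_dirichlet_prior[OF \<alpha> t] by (intro exI[of _ "\<lambda>\<gamma>. ennreal (dirichlet_gamma_density \<alpha> t \<gamma>)"] conjI exI[of _ 1]) auto
qed

section \<open>Reflection of the log ratios and the asymmetry for three teams\<close>

lemma sigma_finite_gamma_space: "sigma_finite_measure (gamma_space t)"
  unfolding gamma_space_def by (rule plborel.sigma_finite) simp

lemma measurable_neg_gamma [measurable]: "neg_gamma t \<in> measurable (gamma_space t) (gamma_space t)"
  unfolding neg_gamma_def gamma_space_def by measurable

lemma distr_gamma_space_neg_gamma: "distr (gamma_space t) (gamma_space t) (neg_gamma t) = gamma_space t"
proof -
  have d: "distr lborel lborel uminus = (lborel :: real measure)"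
    using lborel_distr_uminus by (simp cong: distr_cong)
  show ?thesis
    unfolding gamma_space_def neg_gamma_def
    using distr_PiM_componentwise[of "{1..<t}" "\<lambda>_. lborel" "\<lambda>_. lborel" "\<lambda>_. uminus :: real \<Rightarrow> real"]
    by (simp add: d sigma_finite_lborel)
qed

lemma neg_gamma_neg_gamma: "\<gamma> \<in> space (gamma_space t) \<Longrightarrow> neg_gamma t (neg_gamma t \<gamma>) = \<gamma>"
  by (auto simp: neg_gamma_def gamma_space_def space_PiM PiE_iff extensional_def fun_eq_iff)

lemma distr_density_neg_gamma:
  assumes f[measurable]: "f \<in> borel_measurable (gamma_space t)"
  shows "distr (density (gamma_space t) f) (gamma_space t) (neg_gamma t)
    = density (gamma_space t) (\<lambda>\<gamma>. f (neg_gamma t \<gamma>))"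
proof -
  \<comment> \<open>The density is written as a function of the reflected point so that
    \<open>density_distr\<close> can move it past the image.\<close>
  have "density (gamma_space t) f = density (gamma_space t) (\<lambda>\<gamma>. f (neg_gamma t (neg_gamma t \<gamma>)))"
    by (intro density_cong) (auto simp: neg_gamma_neg_gamma)
  then have "distr (density (gamma_space t) f) (gamma_space t) (neg_gamma t)
    = distr (density (gamma_space t) (\<lambda>\<gamma>. f (neg_gamma t (neg_gamma t \<gamma>)))) (gamma_space t) (neg_gamma t)"
    by simp
  also have "\<dots> = density (distr (gamma_space t) (gamma_space t) (neg_gamma t)) (\<lambda>\<gamma>. f (neg_gamma t \<gamma>))"
    by (subst density_distr) auto
  finally show ?thesis unfolding distr_gamma_space_neg_gamma .
qed

text \<open>The three exponents are \<lambda>_i minus the mean of the \<lambda>_j, so the bracket is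
  the sum of the strengths divided by their geometric mean. This pulls exp (- (\<gamma>_1 +
  \<gamma>_2) / 3) out of \<open>S\<close>, and its power - 3 \<alpha> is the exponential
  numerator.\<close>

lemma dirichlet_gamma_density_3:
  "dirichlet_gamma_density \<alpha> 3 \<gamma> = Gamma (3 * \<alpha>) / Gamma \<alpha> ^ 3 *
     (exp ((gamma_diff 3 \<gamma> 1 2 + gamma_diff 3 \<gamma> 1 3) / 3)
      + exp ((- gamma_diff 3 \<gamma> 1 2 + gamma_diff 3 \<gamma> 2 3) / 3)
      + exp ((- gamma_diff 3 \<gamma> 1 3 - gamma_diff 3 \<gamma> 2 3) / 3)) powr (- 3 * \<alpha>)"
proof -
  define S where "S = 1 + exp (\<gamma> 1) + exp (\<gamma> 2)"
  have S: "0 < S" unfolding S_def by (intro add_pos_pos) auto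
  have s: "{1..<3::nat} = {1, 2}" by auto
  have "exp ((gamma_diff 3 \<gamma> 1 2 + gamma_diff 3 \<gamma> 1 3) / 3)
      + exp ((- gamma_diff 3 \<gamma> 1 2 + gamma_diff 3 \<gamma> 2 3) / 3)
      + exp ((- gamma_diff 3 \<gamma> 1 3 - gamma_diff 3 \<gamma> 2 3) / 3) = exp (- (\<gamma> 1 + \<gamma> 2) / 3) * S"
    unfolding S_def by (simp add: gamma_diff_def distrib_left field_simps flip: exp_add)
  moreover have "(exp (- (\<gamma> 1 + \<gamma> 2) / 3) * S) powr (- 3 * \<alpha>) = exp (\<alpha> * (\<gamma> 1 + \<gamma> 2)) / S powr (3 * \<alpha>)"
  proof -
    have e: "- (\<gamma> 1 + \<gamma> 2) / 3 * (- 3 * \<alpha>) = \<alpha> * (\<gamma> 1 + \<gamma> 2)"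
      by (simp add: algebra_simps)
    have "(exp (- (\<gamma> 1 + \<gamma> 2) / 3) * S) powr (- 3 * \<alpha>)
        = exp (- (\<gamma> 1 + \<gamma> 2) / 3 * (- 3 * \<alpha>)) * S powr (- 3 * \<alpha>)"
      using S by (simp only: powr_mult exp_powr_real exp_ge_zero less_imp_le)
    then show ?thesis unfolding e by (simp add: powr_minus_divide)
  qed
  ultimately show ?thesis
    by (simp only: dirichlet_gamma_density_def s) (simp add: S_def add_ac)
qed

lemma dirichlet_gamma_density_3_not_symmetric:
  assumes \<alpha>: "0 < \<alpha>"
  shows "\<not> (AE \<gamma> in gamma_space 3. ennreal (dirichlet_gamma_density \<alpha> 3 \<gamma>)
    = ennreal (dirichlet_gamma_density \<alpha> 3 (neg_gamma 3 \<gamma>)))"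
proof
  assume "AE \<gamma> in gamma_space 3. ennreal (dirichlet_gamma_density \<alpha> 3 \<gamma>)
    = ennreal (dirichlet_gamma_density \<alpha> 3 (neg_gamma 3 \<gamma>))"
  then obtain N where N: "{\<gamma> \<in> space (gamma_space 3). ennreal (dirichlet_gamma_density \<alpha> 3 \<gamma>)
    \<noteq> ennreal (dirichlet_gamma_density \<alpha> 3 (neg_gamma 3 \<gamma>))} \<subseteq> N"
    "emeasure (gamma_space 3) N = 0" "N \<in> sets (gamma_space 3)"
    by (rule AE_E)
  \<comment> \<open>The box has positive measure and will be shown to lie in the null set
    \<open>N\<close>. It surrounds points with two equal favourites, far enough out for crude
    bounds: the sum of the scaled strengths is below 25/4 + 25/4 + 1 < 16, while the sum of their
    reciprocals exceeds 4 * 4.\<close>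
  define B where "B = Pi\<^sub>E {1..<3::nat} (\<lambda>_. {3 * ln 4<..<3 * ln (5::real)})"
  have B: "B \<in> sets (gamma_space 3)"
    unfolding B_def gamma_space_def by (intro sets_PiM_I_finite) auto
  have "emeasure (gamma_space 3) B = (\<Prod>i\<in>{1..<3::nat}. emeasure lborel {3 * ln 4<..<3 * ln (5::real)})"
    unfolding B_def gamma_space_def by (intro plborel.emeasure_PiM) auto
  also have "\<dots> \<noteq> 0"
    by (simp add: ennreal_eq_0_iff)
  finally have "emeasure (gamma_space 3) B \<noteq> 0" .
  moreover have "B \<subseteq> N"
  proof
    fix \<gamma> assume \<gamma>: "\<gamma> \<in> B"
    define u v where "u = exp (\<gamma> 1 / 3)" and "v = exp (\<gamma> 2 / 3)"
    have "3 * ln 4 < \<gamma> i \<and> \<gamma> i < 3 * ln 5" if "i \<in> {1..<3}" for i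
      using \<gamma> that by (auto simp: B_def PiE_iff)
    then have r: "exp (ln 4) < exp (\<gamma> i / 3) \<and> exp (\<gamma> i / 3) < exp (ln 5)" if "i \<in> {1..<3}" for i
      using that unfolding exp_less_cancel_iff by force
    have uv: "4 < u" "u < 5" "4 < v" "v < 5"
      using r[of 1] r[of 2] by (auto simp: u_def v_def)
    define q where "q \<gamma> = exp ((gamma_diff 3 \<gamma> 1 2 + gamma_diff 3 \<gamma> 1 3) / 3)
      + exp ((- gamma_diff 3 \<gamma> 1 2 + gamma_diff 3 \<gamma> 2 3) / 3)
      + exp ((- gamma_diff 3 \<gamma> 1 3 - gamma_diff 3 \<gamma> 2 3) / 3)" for \<gamma>
    have E: "exp (\<gamma> 1 * 2 / 3) = u * u" "exp (\<gamma> 2 * 2 / 3) = v * v"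
      by (simp_all add: u_def v_def flip: exp_add)
    have "q \<gamma> = u * u / v + v * v / u + 1 / (u * v)"
      by (simp add: q_def gamma_diff_def u_def v_def field_simps flip: exp_add exp_diff exp_minus)
    also have "\<dots> < 16"
    proof -
      have "u * u < 5 * 5" "v * v < 5 * 5"
        using uv by (intro mult_strict_mono; simp)+
      \<comment> \<open>From 25 = 25/4 * 4 and 4 < u, 4 < v.\<close>
      then have "u * u < 25 / 4 * v" "v * v < 25 / 4 * u"
        using uv by simp_all
      then have "u * u / v < 25 / 4" "v * v / u < 25 / 4"
        using uv by (simp_all only: pos_divide_less_eq)
      moreover have "1 / (u * v) < 1"
        using uv mult_strict_mono[of 1 u 1 v] by simp
      ultimately show ?thesis by linarith
    qed
    also have "\<dots> < u * v"
      using uv mult_strict_mono[of 4 u 4 v] by simp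
    \<comment> \<open>\<open>u * v\<close> is the reciprocal of the scaled strength of team 3, one
      of three positive summands.\<close>
    also have "\<dots> < q (neg_gamma 3 \<gamma>)"
      by (simp add: q_def gamma_diff_def neg_gamma_def u_def v_def add_divide_distrib add_pos_pos flip: exp_add)
    finally have "q \<gamma> < q (neg_gamma 3 \<gamma>)" .
    moreover have "0 < q \<gamma>" unfolding q_def by (intro add_pos_pos) auto
    ultimately have "q (neg_gamma 3 \<gamma>) powr (- 3 * \<alpha>) < q \<gamma> powr (- 3 * \<alpha>)"
      using \<alpha> by (intro powr_less_mono2_neg) auto
    moreover have c: "0 < Gamma (3 * \<alpha>) / Gamma \<alpha> ^ 3"
      using \<alpha> Gamma_real_pos by simp
    ultimately have "dirichlet_gamma_density \<alpha> 3 (neg_gamma 3 \<gamma>) < dirichlet_gamma_density \<alpha> 3 \<gamma>"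
      unfolding dirichlet_gamma_density_3 q_def[symmetric] by (intro mult_strict_left_mono)
    \<comment> \<open>\<open>ennreal\<close> sends all negative reals to 0, so the strict inequality
      survives only with this bound.\<close>
    moreover have "0 \<le> dirichlet_gamma_density \<alpha> 3 (neg_gamma 3 \<gamma>)"
      unfolding dirichlet_gamma_density_3 using c by (intro mult_nonneg_nonneg) auto
    ultimately have "ennreal (dirichlet_gamma_density \<alpha> 3 \<gamma>) \<noteq> ennreal (dirichlet_gamma_density \<alpha> 3 (neg_gamma 3 \<gamma>))"
      by simp
    then show "\<gamma> \<in> N" using N(1) \<gamma> sets.sets_into_space[OF B] by blast
  qed
  then have "emeasure (gamma_space 3) B \<le> emeasure (gamma_space 3) N"
    using N(3) by (rule emeasure_mono)
  ultimately show False using N(2) by simp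
qed

lemma density_gamma_space_unique:
  assumes "f \<in> borel_measurable (gamma_space t)" "g \<in> borel_measurable (gamma_space t)"
    "density (gamma_space t) f = density (gamma_space t) g"
  shows "AE \<gamma> in gamma_space t. f \<gamma> = g \<gamma>"
  using sigma_finite_measure.density_unique[OF sigma_finite_gamma_space assms] .

lemma induced_density_dirichlet_prior_3_not_symmetric:
  assumes \<alpha>: "0 < \<alpha>" and f: "induces_density 3 (dirichlet_prior \<alpha> 3) f"
  shows "\<not> (AE \<gamma> in gamma_space 3. f \<gamma> = f (neg_gamma 3 \<gamma>))"
proof
  let ?F = "\<lambda>\<gamma>. ennreal (dirichlet_gamma_density \<alpha> 3 \<gamma>)"
  assume sym: "AE \<gamma> in gamma_space 3. f \<gamma> = f (neg_gamma 3 \<gamma>)"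
  have fF: "AE \<gamma> in gamma_space 3. f \<gamma> = ?F \<gamma>"
    using f induces_density_dirichlet_prior[OF \<alpha>, of 3]
    by (intro density_gamma_space_unique) (auto simp: induces_density_def distributed_def)
  \<comment> \<open>Agreement almost everywhere carries over to reflected points because the
    reflection preserves the measure.\<close>
  then have "AE \<gamma> in distr (gamma_space 3) (gamma_space 3) (neg_gamma 3). f \<gamma> = ?F \<gamma>"
    unfolding distr_gamma_space_neg_gamma .
  then have "AE \<gamma> in gamma_space 3. f (neg_gamma 3 \<gamma>) = ?F (neg_gamma 3 \<gamma>)"
    by (rule AE_distrD[OF measurable_neg_gamma])
  with sym fF have "AE \<gamma> in gamma_space 3. ?F \<gamma> = ?F (neg_gamma 3 \<gamma>)"
    by eventually_elim simp
  then show False using dirichlet_gamma_density_3_not_symmetric[OF \<alpha>] by simp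
qed

lemma not_win_loss_invariant_dirichlet_prior_3:
  assumes \<alpha>: "0 < \<alpha>"
  shows "\<not> win_loss_invariant 3 (dirichlet_prior \<alpha> 3)"
proof
  let ?F = "\<lambda>\<gamma>. ennreal (dirichlet_gamma_density \<alpha> 3 \<gamma>)"
  let ?I = "\<lambda>\<pi>::nat \<Rightarrow> real. \<lambda>k\<in>{1..3::nat}. 1 / \<pi> k"
  assume "win_loss_invariant 3 (dirichlet_prior \<alpha> 3)"
  then obtain f g where f: "induces_density 3 (distr (dirichlet_prior \<alpha> 3) (strength_space 3) ?I) f"
    and g: "induces_density 3 (dirichlet_prior \<alpha> 3) g" and fg: "AE \<gamma> in gamma_space 3. f \<gamma> = g \<gamma>"
    unfolding win_loss_invariant_def prior_equiv_def by blast
  have go: "gamma_of 3 \<in> measurable (strength_space 3) (gamma_space 3)"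
    by (rule measurable_gamma_of) simp
  then have goD: "gamma_of 3 \<in> measurable (dirichlet_prior \<alpha> 3) (gamma_space 3)"
    by (simp add: measurable_cong_sets[OF sets_dirichlet_prior refl])
  have "?I \<in> measurable (strength_space 3) (strength_space 3)"
    unfolding strength_space_def by measurable
  then have I: "?I \<in> measurable (dirichlet_prior \<alpha> 3) (strength_space 3)"
    by (simp add: measurable_cong_sets[OF sets_dirichlet_prior refl])
  \<comment> \<open>Inverting the strengths negates the log ratios, so invariance would make the
    density \<open>g\<close> even almost everywhere.\<close>
  have "gamma_of 3 \<circ> ?I = neg_gamma 3 \<circ> gamma_of 3"
    by (auto simp: fun_eq_iff gamma_of_def neg_gamma_def ln_inverse inverse_eq_divide[symmetric])
  then have "density (gamma_space 3) f = distr (dirichlet_prior \<alpha> 3) (gamma_space 3) (neg_gamma 3 \<circ> gamma_of 3)"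
    using f distr_distr[OF go I] by (simp add: induces_density_def distributed_def)
  also have "\<dots> = distr (distr (dirichlet_prior \<alpha> 3) (gamma_space 3) (gamma_of 3)) (gamma_space 3) (neg_gamma 3)"
    by (rule distr_distr[OF measurable_neg_gamma goD, symmetric])
  also have "distr (dirichlet_prior \<alpha> 3) (gamma_space 3) (gamma_of 3) = density (gamma_space 3) g"
    using g by (simp add: induces_density_def distributed_def)
  also have "distr (density (gamma_space 3) g) (gamma_space 3) (neg_gamma 3)
      = density (gamma_space 3) (\<lambda>\<gamma>. g (neg_gamma 3 \<gamma>))"
    using g by (intro distr_density_neg_gamma) (simp add: induces_density_def distributed_def)
  finally have "AE \<gamma> in gamma_space 3. f \<gamma> = g (neg_gamma 3 \<gamma>)"
    using f g by (intro density_gamma_space_unique) (auto simp: induces_density_def distributed_def)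
  with fg have "AE \<gamma> in gamma_space 3. g \<gamma> = g (neg_gamma 3 \<gamma>)"
    by eventually_elim simp
  then show False using induced_density_dirichlet_prior_3_not_symmetric[OF \<alpha> g] by simp
qed

theorem mainTheorem10:
  fixes \<alpha> :: real
  assumes "\<alpha> > 0"
  shows "(\<forall>t\<ge>2. team_interchange_invariant t (dirichlet_prior \<alpha> t))
    \<and> (\<forall>t\<ge>2. normalizable t (dirichlet_prior \<alpha> t))
    \<and> elimination_invariant (dirichlet_prior \<alpha>)
    \<and> \<not> (\<forall>t\<ge>2. win_loss_invariant t (dirichlet_prior \<alpha> t))
    \<and> \<not> win_loss_invariant 3 (dirichlet_prior \<alpha> 3)
    \<and> (\<exists>c::real. c > 0 \<and> induces_density 3 (dirichlet_prior \<alpha> 3)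
          (\<lambda>\<gamma>. ennreal (c *
             (exp ((gamma_diff 3 \<gamma> 1 2 + gamma_diff 3 \<gamma> 1 3) / 3)
              + exp ((- gamma_diff 3 \<gamma> 1 2 + gamma_diff 3 \<gamma> 2 3) / 3)
              + exp ((- gamma_diff 3 \<gamma> 1 3 - gamma_diff 3 \<gamma> 2 3) / 3)) powr (- 3 * \<alpha>))))
    \<and> (\<forall>f. induces_density 3 (dirichlet_prior \<alpha> 3) f \<longrightarrow>
          \<not> (AE \<gamma> in gamma_space 3. f \<gamma> = f (neg_gamma 3 \<gamma>)))"
proof (intro conjI allI impI)
  show "\<not> win_loss_invariant 3 (dirichlet_prior \<alpha> 3)"
    by (rule not_win_loss_invariant_dirichlet_prior_3[OF assms])
  \<comment> \<open>The witness is t = 3. For t = 2 exchanging the teams negates the only log ratio,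
    so the symmetry does hold there.\<close>
  then show "\<not> (\<forall>t\<ge>2. win_loss_invariant t (dirichlet_prior \<alpha> t))"
    by (metis numeral_le_iff semiring_norm(68,72))
  show "\<exists>c::real. c > 0 \<and> induces_density 3 (dirichlet_prior \<alpha> 3)
          (\<lambda>\<gamma>. ennreal (c *
             (exp ((gamma_diff 3 \<gamma> 1 2 + gamma_diff 3 \<gamma> 1 3) / 3)
              + exp ((- gamma_diff 3 \<gamma> 1 2 + gamma_diff 3 \<gamma> 2 3) / 3)
              + exp ((- gamma_diff 3 \<gamma> 1 3 - gamma_diff 3 \<gamma> 2 3) / 3)) powr (- 3 * \<alpha>)))"
    using induces_density_dirichlet_prior[OF assms, of 3] assms Gamma_real_pos
    unfolding dirichlet_gamma_density_3 by (intro exI[of _ "Gamma (3 * \<alpha>) / Gamma \<alpha> ^ 3"] conjI) auto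
qed (use assms in \<open>auto intro: team_interchange_invariant_dirichlet_prior normalizable_dirichlet_prior
      elimination_invariant_dirichlet_prior dest: induced_density_dirichlet_prior_3_not_symmetric\<close>)

end
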